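(* Let $n\ge1$ and let $\chi_1,\dots,\chi_n:\mathbb{R}\to\mathbb{R}$ be functions in $L^1(\mathbb{R})$, each bounded in a neighborhood of $0\in\mathbb{R}$. Suppose that for some $\beta>0$ and some $\alpha>0$ the following hold for every $i=1,\dots,n$: $$\sup_{x\in\mathbb{R}}\sum_{k\in\mathbb{Z}}|\chi_i(x-k)|\,|x-k|^\beta<+\infty,$$ $$\sum_{k\in\mathbb{Z}}\chi_i(x-k)=1\quad\text{for every }x\in\mathbb{R},$$ and, for every $\widetilde{M}>0$, $$\int_{|x|>\widetilde{M}}w\,|\chi_i(wx)|\,dx=\mathcal{O}(w^{-\alpha})\quad\text{as } w\to+\infty.$$ Define $\chi(\underline{x}):=\prod_{i=1}^n\chi_i(x_i)$ for $\underline{x}=(x_1,\dots,x_n)\in\mathbb{R}^n$. Then $\chi$ is a multivariate kernel for the uniform sampling scheme $t_{\underline{k}}=\underline{k}$; more precisely, $\chi$ satisfies $(\chi 1)$, it satisfies $(\chi 2)$ for every $\mu>0$ (indeed $\sum_{\underline{k}\in\mathbb{Z}^n}\chi(w\underline{x}-\underline{k})=1$ for every $\underline{x}\in\mathbb{R}^n$ and $w>0$), it satisfies $(\chi 3)$ with the given $\beta$, and it satisfies $(\chi 4)$ with the given $\alpha$.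
   Context: For the uniform sampling scheme $t_{\underline{k}}=\underline{k}$, $\underline{k}\in\mathbb{Z}^n$, a function $\chi:\mathbb{R}^n\to\mathbb{R}$ is called a kernel if it satisfies the following conditions ($\|\cdot\|_2$ is the Euclidean norm): - $(\chi 1)$ $\chi\in L^1(\mathbb{R}^n)$ and $\chi$ is bounded in a neighborhood of the origin; - $(\chi 2)$ for some $\mu>0$, $\sum_{\underline{k}\in\mathbb{Z}^n}\chi(w\underline{x}-\underline{k})-1=\mathcal{O}(w^{-\mu})$ as $w\to+\infty$, uniformly with respect to $\underline{x}\in\mathbb{R}^n$; - $(\chi 3)$ for some $\beta>0$, $\sup_{\underline{u}\in\mathbb{R}^n}\sum_{\underline{k}\in\mathbb{Z}^n}|\chi(\underline{u}-\underline{k})|\,\|\underline{u}-\underline{k}\|_2^\beta<+\infty$; - $(\chi 4)$ there exists $\alpha>0$ such that, for every $M>0$, $\int_{\|\underline{u}\|_2>M}w^n|\chi(w\underline{u})|\,d\underline{u}=\mathcal{O}(w^{-\alpha})$ as $w\to+\infty$. *)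

theory Defs
  imports "HOL-Analysis.Analysis"
begin

text \<open>
  The space of the paper is \<open>real ^ 'n\<close> with \<open>n = CARD('n)\<close> (so \<open>n \<ge> 1\<close> always holds), and its
  \<open>norm\<close> is the Euclidean one. \<open>L\<^sup>1\<close> refers to Lebesgue measure, not to its Borel restriction
  \<open>lborel\<close>.
\<close>

definition lattice_point :: "int ^ 'n \<Rightarrow> real ^ 'n" where
  "lattice_point k = (\<chi> i. real_of_int (k $ i))"

definition chi1 :: "(real ^ 'n \<Rightarrow> real) \<Rightarrow> bool" where
  "chi1 f \<longleftrightarrow> integrable lebesgue f \<and> Bfun f (nhds 0)"

text \<open>
  The constant of the O-bound must not depend on \<open>x\<close>, so the quantifier over \<open>x\<close> is inside
  \<open>eventually\<close>. Summability is demanded because \<open>infsum\<close> is \<open>0\<close> for families that are not summable.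
\<close>

definition chi2 :: "real \<Rightarrow> (real ^ 'n \<Rightarrow> real) \<Rightarrow> bool" where
  "chi2 \<mu> f \<longleftrightarrow>
    (\<exists>C. \<forall>\<^sub>F w in at_top. \<forall>x.
       (\<lambda>k. f (w *\<^sub>R x - lattice_point k)) summable_on UNIV \<and>
       \<bar>(\<Sum>\<^sub>\<infinity>k. f (w *\<^sub>R x - lattice_point k)) - 1\<bar> \<le> C * w powr (- \<mu>))"

text \<open>Sums and supremum are taken in \<open>[0, \<infinity>]\<close>, so no summability side condition is needed here.\<close>

definition chi3 :: "real \<Rightarrow> (real ^ 'n \<Rightarrow> real) \<Rightarrow> bool" where
  "chi3 \<beta> f \<longleftrightarrow>
    (SUP u. \<Sum>\<^sub>\<infinity>k. ennreal (\<bar>f (u - lattice_point k)\<bar> * norm (u - lattice_point k) powr \<beta>)) < \<infinity>"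

definition chi4 :: "real \<Rightarrow> (real ^ 'n \<Rightarrow> real) \<Rightarrow> bool" where
  "chi4 \<alpha> f \<longleftrightarrow>
    (\<forall>M>0. (\<lambda>w. LINT u:{u. norm u > M}|lebesgue. w ^ CARD('n) * \<bar>f (w *\<^sub>R u)\<bar>)
              \<in> O[at_top](\<lambda>w. w powr (- \<alpha>)))"

definition is_kernel :: "(real ^ 'n \<Rightarrow> real) \<Rightarrow> bool" where
  "is_kernel f \<longleftrightarrow>
    chi1 f \<and> (\<exists>\<mu>>0. chi2 \<mu> f) \<and> (\<exists>\<beta>>0. chi3 \<beta> f) \<and> (\<exists>\<alpha>>0. chi4 \<alpha> f)"

definition product_function :: "('n::finite \<Rightarrow> real \<Rightarrow> real) \<Rightarrow> real ^ 'n \<Rightarrow> real" where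
  "product_function c x = (\<Prod>i\<in>UNIV. c i (x $ i))"

end

theory Submission
  imports Defs
begin

text \<open>
  Sums over the lattice and integrals of the product function factor into one-dimensional ones. As
  \<open>norm v \<le> n * \<bar>v $ i\<bar>\<close> for some \<open>i\<close>, both the weight \<open>norm v powr \<beta>\<close> and the indicator of
  \<open>norm v > M\<close> are dominated by sums over \<open>i\<close> of functions of the single coordinate \<open>v $ i\<close>, so
  \<open>(\<chi>3)\<close> and \<open>(\<chi>4)\<close> reduce to the hypothesis on \<open>c i\<close>, with the other factors contributing the
  constants \<open>sup\<^sub>x \<Sum>\<^sub>k \<bar>c j (x - k)\<bar>\<close> and \<open>\<integral> \<bar>c j\<bar>\<close>.
\<close>

section \<open>Lebesgue integrals of products of functions of single coordinates\<close>

text \<open>Passes from products indexed by \<open>Basis\<close>, the form in which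
  \<open>lborel\<close> factors, to products indexed by coordinates. The basis vector serves
  \<open>G\<close> only as an index.\<close>

lemma prod_Basis_vec:
  fixes x :: "real ^ 'n" and G :: "real ^ 'n \<Rightarrow> real \<Rightarrow> 'a :: comm_monoid_mult"
  shows "(\<Prod>b\<in>Basis. G b (x \<bullet> b)) = (\<Prod>i\<in>UNIV. G (axis i 1) (x $ i))"
proof -
  have basis: "(Basis :: (real ^ 'n) set) = range (\<lambda>i. axis i 1)"
    by (auto simp: Basis_vec_def)
  have inj: "inj (\<lambda>i::'n. axis i (1::real))"
    by (simp add: inj_def axis_eq_axis)
  show ?thesis
    unfolding basis prod.reindex[OF inj] by (simp add: o_def cart_eq_inner_axis)
qed

text \<open>The preimage of a null set \<open>N\<close> under a coordinate projection is a box with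
  side \<open>N\<close> in direction \<open>i\<close> and the whole line in all other directions, so
  its measure is a product with a zero factor.\<close>

lemma AE_lborel_component:
  fixes i :: "'n::finite"
  assumes "AE y in lborel. P y"
  shows "AE x in lborel. P ((x :: real ^ 'n) $ i)"
proof -
  obtain N where N: "{y. \<not> P y} \<subseteq> N" "N \<in> sets borel" "emeasure lborel N = 0"
    using AE_E[OF assms] by auto
  let ?f = "\<lambda>b y. if b = axis i 1 then indicator N y else 1 :: ennreal"
  have S [measurable]: "{x::real^'n. x $ i \<in> N} \<in> sets borel"
    using N(2) by measurable
  have "(\<Prod>b\<in>Basis. ?f b (x \<bullet> b)) = indicator {x. x $ i \<in> N} x" for x :: "real^'n"
    unfolding prod_Basis_vec[of ?f] by (simp add: axis_eq_axis prod.delta indicator_def)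
  then have "emeasure lborel {x::real^'n. x $ i \<in> N} = (\<integral>\<^sup>+x. (\<Prod>b\<in>(Basis :: (real^'n) set). ?f b (x \<bullet> b)) \<partial>lborel)"
    using S by (simp only: nn_integral_indicator sets_lborel)
  also have "\<dots> = (\<Prod>b\<in>(Basis :: (real^'n) set). (\<integral>\<^sup>+y. ?f b y \<partial>lborel))"
    using N(2) by (intro nn_integral_lborel_prod) auto
  \<comment> \<open>The factor at \<open>axis i 1\<close> is 0 and the others are infinite; in
    \<open>ennreal\<close> such a product is 0.\<close>
  also have "\<dots> = 0"
    using N(2,3) by (intro prod_zero) (auto intro!: bexI[of _ "axis i 1"])
  finally show ?thesis
    using N(1) S by (intro AE_I[of _ _ "{x. x $ i \<in> N}"]) auto
qed

text \<open>Fubini for the product measure, applied to Borel functions \<open>g i\<close> that agree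
  with \<open>h i\<close> almost everywhere. The detour is made because \<open>lborel\<close>, and
  not its completion, is an image of a product measure. \<open>AE_lborel_component\<close> carries
  the result back to \<open>h\<close>.\<close>

lemma
  fixes h :: "'n::finite \<Rightarrow> real \<Rightarrow> real"
  assumes h: "\<And>i. integrable lebesgue (h i)"
  shows integrable_lebesgue_prod_vec: "integrable lebesgue (\<lambda>x. \<Prod>i\<in>UNIV. h i (x $ i))"
    and integral_lebesgue_prod_vec:
      "(LINT x|lebesgue. (\<Prod>i\<in>UNIV. h i (x $ i))) = (\<Prod>i\<in>UNIV. (LINT y|lebesgue. h i y))"
proof -
  have "\<exists>g. g \<in> borel_measurable lborel \<and> (AE y in lborel. h i y = g y)" for i
    using completion_ex_borel_measurable_real[OF borel_measurable_integrable[OF h]] by blast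
  then obtain g where gm: "\<And>i. g i \<in> borel_measurable lborel"
    and g: "\<And>i. AE y in lborel. h i y = g i y"
    by metis
  note [measurable] = gm[unfolded measurable_lborel1]
  have hm: "h i \<in> borel_measurable lebesgue" for i
    using h by (rule borel_measurable_integrable)
  have gm': "g i \<in> borel_measurable lebesgue" for i
    using gm by (rule measurable_completion)
  have gl: "integrable lborel (g i)" "(LINT y|lborel. g i y) = (LINT y|lebesgue. h i y)" for i
  proof -
    have ae: "AE y in lebesgue. h i y = g i y"
      using g by (rule AE_completion)
    show "integrable lborel (g i)"
      using integrable_cong_AE[OF hm gm' ae] h integrable_completion[OF gm] by simp
    show "(LINT y|lborel. g i y) = (LINT y|lebesgue. h i y)"
      using integral_cong_AE[OF hm gm' ae] integral_completion[OF gm, of i] by simp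
  qed
  interpret product_sigma_finite "\<lambda>b::real^'n. lborel :: real measure"
    by standard
  \<comment> \<open>Reindexes \<open>g\<close> by basis vectors. Every \<open>G b\<close> is one of
    the \<open>g i\<close>, even for \<open>b\<close> outside \<open>Basis\<close>, so measurability
    and integrability hold for all \<open>b\<close>.\<close>
  define G where "G b = g (THE i. b = axis i 1)" for b :: "real ^ 'n"
  have G: "G (axis i 1) = g i" for i
    by (simp add: G_def axis_eq_axis)
  have Gm [measurable]: "G b \<in> borel_measurable borel" for b
    unfolding G_def by measurable
  have Gi: "integrable lborel (G b)" for b
    unfolding G_def by (rule gl)
  have eq: "(\<Prod>i\<in>UNIV. g i (x $ i)) = (\<Prod>b\<in>Basis. G b (x \<bullet> b))" for x
    by (simp add: prod_Basis_vec G)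
  \<comment> \<open>By \<open>lborel_eq\<close>, \<open>lborel\<close> is the image of the product
    measure under the map that assembles a vector from its coefficients \<open>f\<close>; this is
    the integrand pulled back along that map.\<close>
  have basis: "(\<Prod>b\<in>Basis. G b ((\<Sum>b\<in>Basis. f b *\<^sub>R b) \<bullet> b)) = (\<Prod>b\<in>Basis. G b (f b))" for f
    by (intro prod.cong) auto
  have Pm [measurable]: "(\<lambda>x::real^'n. \<Prod>i\<in>UNIV. g i (x $ i)) \<in> borel_measurable borel"
    by measurable
  have Pi: "integrable lborel (\<lambda>x::real^'n. \<Prod>i\<in>UNIV. g i (x $ i))"
    unfolding eq
    by (subst lborel_eq, subst integrable_distr_eq)
      (auto simp: basis intro!: product_integrable_prod Gi)
  have Pint: "(LINT x|lborel. (\<Prod>i\<in>UNIV. g i (x $ i))) = (\<Prod>i\<in>UNIV. (LINT y|lborel. g i y))"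
  proof -
    have "(LINT x|lborel. (\<Prod>i\<in>UNIV. g i (x $ i))) = (\<Prod>b\<in>Basis. (LINT y|lborel. G b y))"
      unfolding eq
      by (subst lborel_eq, subst integral_distr)
        (auto simp: basis intro!: product_integral_prod Gi)
    also have "\<dots> = (\<Prod>i\<in>UNIV. (LINT y|lborel. g i y))"
      using prod_Basis_vec[where G="\<lambda>b _. (LINT y|lborel. G b y)"] by (simp add: G)
    finally show ?thesis .
  qed
  have "AE x in lborel. \<forall>i. h i ((x::real^'n) $ i) = g i (x $ i)"
    using g by (subst AE_all_countable) (auto intro: AE_lborel_component)
  then have ae: "AE x in lborel. (\<Prod>i\<in>UNIV. g i ((x::real^'n) $ i)) = (\<Prod>i\<in>UNIV. h i (x $ i))"
    by eventually_elim simp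
  have gP: "(\<lambda>x::real^'n. \<Prod>i\<in>UNIV. g i (x $ i)) \<in> borel_measurable lebesgue"
    using Pm by (intro measurable_completion) simp
  \<comment> \<open>Completeness of \<open>lebesgue\<close> transfers measurability from the almost
    everywhere equal product of the \<open>g i\<close>.\<close>
  have hP: "(\<lambda>x::real^'n. \<Prod>i\<in>UNIV. h i (x $ i)) \<in> borel_measurable lebesgue"
    using gP AE_completion[OF ae] by (rule borel_measurable_AE)
  show "integrable lebesgue (\<lambda>x. \<Prod>i\<in>UNIV. h i (x $ i))"
    using integrable_cong_AE[OF gP hP AE_completion[OF ae]] Pi Pm by (simp add: integrable_completion)
  show "(LINT x|lebesgue. (\<Prod>i\<in>UNIV. h i (x $ i))) = (\<Prod>i\<in>UNIV. (LINT y|lebesgue. h i y))"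
    using integral_cong_AE[OF gP hP AE_completion[OF ae]] Pint Pm gl by (simp add: integral_completion)
qed

section \<open>Bounds for lattice sums and their factorization\<close>

text \<open>The sum of a nonnegative family in \<open>ennreal\<close> is the supremum of its finite
  partial sums. This lets the estimates for \<open>chi3\<close> be carried out on finite real
  sums.\<close>

lemma Sup_infsum_ennreal_finite_iff:
  fixes f :: "'a \<Rightarrow> 'b \<Rightarrow> real"
  assumes "\<And>x k. f x k \<ge> 0"
  shows "(SUP x. \<Sum>\<^sub>\<infinity>k. ennreal (f x k)) < \<infinity> \<longleftrightarrow> (\<exists>K\<ge>0. \<forall>x F. finite F \<longrightarrow> sum (f x) F \<le> K)"
    (is "?L \<longleftrightarrow> ?R")
proof
  assume L: ?L
  then obtain K where K: "(SUP x. \<Sum>\<^sub>\<infinity>k. ennreal (f x k)) = ennreal K" "K \<ge> 0"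
    by (cases "SUP x. \<Sum>\<^sub>\<infinity>k. ennreal (f x k)") auto
  have "sum (f x) F \<le> K" if "finite F" for x F
  proof -
    have "ennreal (sum (f x) F) = (\<Sum>k\<in>F. ennreal (f x k))"
      using assms by simp
    also have "\<dots> \<le> (\<Sum>\<^sub>\<infinity>k. ennreal (f x k))"
      using that by (subst nonneg_infsum_complete) (auto intro!: SUP_upper)
    also have "\<dots> \<le> ennreal K"
      unfolding K(1)[symmetric] by (rule SUP_upper) simp
    finally show ?thesis
      using K(2) by simp
  qed
  then show ?R using K(2) by blast
next
  assume ?R
  then obtain K where K: "\<And>x F. finite F \<Longrightarrow> sum (f x) F \<le> K"
    by blast
  have "(\<Sum>\<^sub>\<infinity>k. ennreal (f x k)) \<le> ennreal K" for x
    using K assms by (intro infsum_le_finite_sums nonneg_summable_on_complete) (auto intro!: ennreal_leI)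
  then have "(SUP x. \<Sum>\<^sub>\<infinity>k. ennreal (f x k)) \<le> ennreal K"
    by (intro SUP_least)
  then show ?L
    using ennreal_less_top le_less_trans by fastforce
qed

text \<open>
  Near the lattice point closest to \<open>x\<close> the weight \<open>\<bar>x - k\<bar> powr \<beta>\<close> gives no control; there at most
  two terms occur, and these are bounded by assumption.
\<close>

lemma translates_sum_bounded:
  fixes f :: "real \<Rightarrow> real"
  assumes "\<beta> > 0" and "Bfun f (nhds 0)"
    and K: "\<And>x F. finite F \<Longrightarrow> (\<Sum>k\<in>F. \<bar>f (x - real_of_int k)\<bar> * \<bar>x - real_of_int k\<bar> powr \<beta>) \<le> K"
  obtains A where "\<And>x F. finite F \<Longrightarrow> (\<Sum>k\<in>F. \<bar>f (x - real_of_int k)\<bar>) \<le> A"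
proof -
  obtain B where B: "B > 0" "\<forall>\<^sub>F y in nhds 0. norm (f y) \<le> B"
    using assms(2) by (auto simp: Bfun_def)
  then obtain d' where d': "d' > 0" "\<And>y. \<bar>y\<bar> < d' \<Longrightarrow> \<bar>f y\<bar> \<le> B"
    by (auto simp: eventually_nhds_metric)
  \<comment> \<open>The cap at 1 makes \<open>\<bar>y\<bar> < d\<close> imply
    \<open>\<bar>y\<bar> < 1\<close>, a condition that at most two integer translates
    satisfy.\<close>
  define d where "d = min d' 1"
  have d: "d > 0" "d \<le> 1" "\<And>y. \<bar>y\<bar> < d \<Longrightarrow> \<bar>f y\<bar> \<le> B"
    using d' by (auto simp: d_def)
  \<comment> \<open>The first summand dominates for \<open>\<bar>y\<bar> < d\<close>; elsewhere the
    weight is at least \<open>d powr \<beta>\<close>, and the second one does.\<close>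
  have *: "\<bar>f y\<bar> \<le> B * of_bool (\<bar>y\<bar> < 1) + (\<bar>f y\<bar> * \<bar>y\<bar> powr \<beta>) / d powr \<beta>" for y
  proof (cases "\<bar>y\<bar> < d")
    case True
    then show ?thesis using d by (simp add: add_increasing2)
  next
    case False
    then have "d powr \<beta> \<le> \<bar>y\<bar> powr \<beta>"
      using d(1) assms(1) by (intro powr_mono2) auto
    then have "\<bar>f y\<bar> * d powr \<beta> \<le> \<bar>f y\<bar> * \<bar>y\<bar> powr \<beta>"
      by (intro mult_left_mono) auto
    then have "\<bar>f y\<bar> \<le> (\<bar>f y\<bar> * \<bar>y\<bar> powr \<beta>) / d powr \<beta>"
      using d(1) by (simp add: pos_le_divide_eq)
    then show ?thesis
      using B(1) by (simp add: add_increasing)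
  qed
  have "(\<Sum>k\<in>F. \<bar>f (x - real_of_int k)\<bar>) \<le> B * 2 + K / d powr \<beta>" if F: "finite F" for x F
  proof -
    have "{k. \<bar>x - real_of_int k\<bar> < 1} \<subseteq> {\<lfloor>x\<rfloor>, \<lfloor>x\<rfloor> + 1}"
      by safe linarith
    then have "card (F \<inter> {k. \<bar>x - real_of_int k\<bar> < 1}) \<le> card {\<lfloor>x\<rfloor>, \<lfloor>x\<rfloor> + 1}"
      by (intro card_mono) auto
    then have c: "real (card (F \<inter> {k. \<bar>x - real_of_int k\<bar> < 1})) \<le> 2"
      by (simp add: card_insert_if split: if_splits)
    have "(\<Sum>k\<in>F. \<bar>f (x - real_of_int k)\<bar>) \<le>
        (\<Sum>k\<in>F. B * of_bool (\<bar>x - real_of_int k\<bar> < 1) +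
          (\<bar>f (x - real_of_int k)\<bar> * \<bar>x - real_of_int k\<bar> powr \<beta>) / d powr \<beta>)"
      by (intro sum_mono *)
    also have "\<dots> = B * real (card (F \<inter> {k. \<bar>x - real_of_int k\<bar> < 1})) +
        (\<Sum>k\<in>F. \<bar>f (x - real_of_int k)\<bar> * \<bar>x - real_of_int k\<bar> powr \<beta>) / d powr \<beta>"
      using F by (simp add: sum.distrib sum_divide_distrib sum_of_bool_eq flip: sum_distrib_left)
    also have "\<dots> \<le> B * 2 + K / d powr \<beta>"
      using B(1) c K[OF F, of x] by (intro add_mono mult_left_mono divide_right_mono) auto
    finally show ?thesis .
  qed
  then show thesis by (rule that)
qed

text \<open>Enlarge \<open>F\<close> to the box spanned by its coordinate projections. The added
  terms are nonnegative, and over the box the sum is a product of one-dimensional finite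
  sums.\<close>

lemma finite_sum_prod_vec_le:
  fixes h :: "'n::finite \<Rightarrow> 'a \<Rightarrow> real"
  assumes "\<And>i k. h i k \<ge> 0" and A: "\<And>i S. finite S \<Longrightarrow> sum (h i) S \<le> A i" and F: "finite F"
  shows "(\<Sum>k\<in>F. \<Prod>i\<in>UNIV. h i (k $ i)) \<le> (\<Prod>i\<in>UNIV. A i)"
proof -
  have "(\<Sum>k\<in>F. \<Prod>i\<in>UNIV. h i (k $ i)) = (\<Sum>g\<in>vec_nth ` F. \<Prod>i\<in>UNIV. h i (g i))"
    by (subst sum.reindex) (auto simp: inj_on_def vec_eq_iff)
  also have "\<dots> \<le> (\<Sum>g\<in>PiE UNIV (\<lambda>i. (\<lambda>k. k $ i) ` F). \<Prod>i\<in>UNIV. h i (g i))"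
    using assms(1) F by (intro sum_mono2 finite_PiE prod_nonneg) auto
  also have "\<dots> = (\<Prod>i\<in>UNIV. sum (h i) ((\<lambda>k. k $ i) ` F))"
    using F by (subst prod_sum_PiE) auto
  also have "\<dots> \<le> (\<Prod>i\<in>UNIV. A i)"
    using assms(1) F by (intro prod_mono conjI sum_nonneg A) auto
  finally show ?thesis .
qed

text \<open>Unordered summability of real families is absolute, so the product of the series may be
  multiplied out. The result is a sum over functions, which \<open>vec_nth\<close> transports to
  vectors.\<close>

lemma has_sum_prod_vec:
  fixes h :: "'n::finite \<Rightarrow> 'a \<Rightarrow> real"
  assumes h: "\<And>i. (h i has_sum 1) UNIV"
  shows "((\<lambda>k. \<Prod>i\<in>UNIV. h i (k $ i)) has_sum 1) UNIV"
proof -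
  have "(\<lambda>k. norm (h i k)) summable_on UNIV" for i
    using h has_sum_imp_summable summable_on_iff_abs_summable_on_real by blast
  then have "(\<Sum>\<^sub>\<infinity>g\<in>PiE UNIV (\<lambda>_. UNIV). \<Prod>i\<in>UNIV. h i (g i)) = (\<Prod>i\<in>UNIV. \<Sum>\<^sub>\<infinity>k. h i k)"
    by (intro infsum_prod_PiE_abs) auto
  also have "\<dots> = 1"
    by (intro prod.neutral ballI infsumI h)
  finally have s: "(\<Sum>\<^sub>\<infinity>g. \<Prod>i\<in>UNIV. h i (g i)) = 1"
    by (simp add: PiE_UNIV_domain)
  \<comment> \<open>an infinite sum that does not exist would be \<open>0\<close>\<close>
  then have "(\<lambda>g. \<Prod>i\<in>UNIV. h i (g i)) summable_on UNIV"
    using infsum_not_exists by fastforce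
  with s have "((\<lambda>g. \<Prod>i\<in>UNIV. h i (g i)) has_sum 1) UNIV"
    by (metis has_sum_infsum)
  moreover have "bij (vec_nth :: 'a ^ 'n \<Rightarrow> _)"
    by (metis bijI' vec_lambda_beta vec_nth_inject vec_lambda_inverse UNIV_I)
  ultimately show ?thesis
    by (subst (asm) has_sum_reindex_bij_betw[symmetric, of vec_nth]) 
qed

section \<open>Dominant coordinates and scaling of integrals\<close>

text \<open>Choose a coordinate of largest absolute value and compare with the l1 norm. The constant
  is not sharp, but any constant depending only on the dimension serves.\<close>

lemma norm_le_card_mult_component:
  fixes v :: "real ^ 'n"
  obtains i where "norm v \<le> CARD('n) * \<bar>v $ i\<bar>"
proof -
  obtain i where i: "\<And>j. \<bar>v $ j\<bar> \<le> \<bar>v $ i\<bar>"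
    using Max_in[of "range (\<lambda>i. \<bar>v $ i\<bar>)"] Max_ge[of "range (\<lambda>i. \<bar>v $ i\<bar>)"]
    by fastforce
  have "norm v \<le> (\<Sum>j\<in>UNIV. \<bar>v $ j\<bar>)"
    by (rule norm_le_l1_cart)
  also have "\<dots> \<le> CARD('n) * \<bar>v $ i\<bar>"
    using sum_mono[of UNIV, OF i] by simp
  finally show thesis ..
qed

text \<open>Change of variables: \<open>lebesgue\<close> is its own image under multiplication by
  \<open>w\<close>, with density \<open>\<bar>w\<bar>\<close>. The factor stays inside the integral
  to match the integrands of the tail condition.\<close>

lemma
  fixes f :: "real \<Rightarrow> real"
  assumes "integrable lebesgue f" and "w \<noteq> 0"
  shows integrable_lebesgue_scale: "integrable lebesgue (\<lambda>y. f (w * y))"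
    and integral_lebesgue_scale: "(LINT y|lebesgue. \<bar>w\<bar> * f (w * y)) = (LINT y|lebesgue. f y)"
proof -
  have [measurable]: "f \<in> borel_measurable lebesgue"
    using assms(1) by (rule borel_measurable_integrable)
  have [measurable]: "(\<lambda>y. w * y) \<in> lebesgue \<rightarrow>\<^sub>M lebesgue"
    using lebesgue_measurable_scaling[of w] by (simp flip: real_scaleR_def)
  have "integrable (density (distr lebesgue lebesgue (\<lambda>y. w * y)) (\<lambda>_. ennreal \<bar>w\<bar>)) f"
    using assms by (simp flip: lebesgue_real_scale)
  then have "integrable lebesgue (\<lambda>y. \<bar>w\<bar> * f (w * y))"
    by (simp add: integrable_density integrable_distr_eq)
  then show "integrable lebesgue (\<lambda>y. f (w * y))"
    using assms(2) by simp
  have "(LINT y|lebesgue. f y) =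
      (LINT y|density (distr lebesgue lebesgue (\<lambda>y. w * y)) (\<lambda>_. ennreal \<bar>w\<bar>). f y)"
    using assms(2) by (simp flip: lebesgue_real_scale)
  also have "\<dots> = (LINT y|lebesgue. \<bar>w\<bar> * f (w * y))"
    by (subst integral_density) (auto simp: integral_distr)
  finally show "(LINT y|lebesgue. \<bar>w\<bar> * f (w * y)) = (LINT y|lebesgue. f y)" ..
qed

section \<open>The four kernel conditions for the product function\<close>

text \<open>Local boundedness pulls back along each projection, which is continuous and maps the
  origin to 0. As there are finitely many coordinates, all bounds hold on a common
  neighborhood.\<close>

lemma chi1_product_function:
  fixes c :: "'n::finite \<Rightarrow> real \<Rightarrow> real"
  assumes "\<And>i. integrable lebesgue (c i)" and "\<And>i. Bfun (c i) (nhds 0)"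
  shows "chi1 (product_function c)"
  unfolding chi1_def
proof
  show "integrable lebesgue (product_function c)"
    unfolding product_function_def[abs_def] using assms(1) by (rule integrable_lebesgue_prod_vec)
  obtain B where B: "\<And>i. \<forall>\<^sub>F y in nhds 0. norm (c i y) \<le> B i"
    using assms(2) unfolding Bfun_def by metis
  have "\<forall>\<^sub>F x in nhds 0. norm (c i ((x :: real ^ 'n) $ i)) \<le> B i" for i
  proof -
    have "filterlim (\<lambda>x::real^'n. x $ i) (nhds 0) (nhds 0)"
      using tendsto_vec_nth[OF filterlim_ident, of i "0::real^'n"] by simp
    with B show ?thesis
      by (rule eventually_compose_filterlim)
  qed
  then have "\<forall>\<^sub>F x in nhds 0. \<forall>i. norm (c i ((x :: real ^ 'n) $ i)) \<le> B i"
    by (rule eventually_all_finite)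
  then have "\<forall>\<^sub>F x in nhds 0. norm (product_function c x) \<le> (\<Prod>i\<in>UNIV. B i)"
    by eventually_elim (auto simp: product_function_def abs_prod intro!: prod_mono)
  then show "Bfun (product_function c) (nhds 0)"
    by (rule BfunI)
qed

lemma has_sum_product_function:
  fixes c :: "'n::finite \<Rightarrow> real \<Rightarrow> real"
  assumes "\<And>i x. ((\<lambda>k::int. c i (x - real_of_int k)) has_sum 1) UNIV"
  shows "((\<lambda>k. product_function c (x - lattice_point k)) has_sum 1) UNIV"
  using has_sum_prod_vec[of "\<lambda>i k. c i (x $ i - real_of_int k)"] assms
  by (simp add: product_function_def lattice_point_def)

lemma chi2_product_function:
  fixes c :: "'n::finite \<Rightarrow> real \<Rightarrow> real"
  assumes "\<And>i x. ((\<lambda>k::int. c i (x - real_of_int k)) has_sum 1) UNIV"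
  shows "chi2 \<mu> (product_function c)"
  unfolding chi2_def
\<comment> \<open>The sum is exactly 1 at every point, so the error vanishes and the constant 0
  works for every \<open>w\<close> and every \<open>\<mu>\<close>.\<close>
proof (intro exI[of _ 0] always_eventually allI conjI)
  fix w :: real and x :: "real ^ 'n"
  note s = has_sum_product_function[where c=c, OF assms, of "w *\<^sub>R x"]
  show "(\<lambda>k. product_function c (w *\<^sub>R x - lattice_point k)) summable_on UNIV"
    using s by (rule has_sum_imp_summable)
  show "\<bar>(\<Sum>\<^sub>\<infinity>k. product_function c (w *\<^sub>R x - lattice_point k)) - 1\<bar> \<le> 0 * w powr - \<mu>"
    using infsumI[OF s] by simp
qed

lemma chi3_product_function:
  fixes c :: "'n::finite \<Rightarrow> real \<Rightarrow> real"
  assumes "\<beta> > 0" and "\<And>i. Bfun (c i) (nhds 0)"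
    and "\<And>i. (SUP x. \<Sum>\<^sub>\<infinity>k::int. ennreal (\<bar>c i (x - real_of_int k)\<bar> * \<bar>x - real_of_int k\<bar> powr \<beta>)) < \<infinity>"
  shows "chi3 \<beta> (product_function c)"
proof -
  have "\<exists>K\<ge>0. \<forall>x F. finite F \<longrightarrow>
      (\<Sum>k\<in>F. \<bar>c i (x - real_of_int k)\<bar> * \<bar>x - real_of_int k\<bar> powr \<beta>) \<le> K" for i
    using assms(3)[of i] by (subst (asm) Sup_infsum_ennreal_finite_iff) auto
  then obtain K where K: "\<And>i x F. finite F \<Longrightarrow>
      (\<Sum>k\<in>F. \<bar>c i (x - real_of_int k)\<bar> * \<bar>x - real_of_int k\<bar> powr \<beta>) \<le> K i"
    by metis
  have "\<exists>A. \<forall>x F. finite F \<longrightarrow> (\<Sum>k\<in>F. \<bar>c i (x - real_of_int k)\<bar>) \<le> A" for i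
    using translates_sum_bounded[OF assms(1,2) K, of i] by metis
  then obtain A where A: "\<And>i x F. finite F \<Longrightarrow> (\<Sum>k\<in>F. \<bar>c i (x - real_of_int k)\<bar>) \<le> A i"
    by metis
  define n where "n = real CARD('n)"
  \<comment> \<open>Here \<open>i\<close> is the coordinate that carries the weight and
    \<open>j\<close> runs through the factors; \<open>B i j\<close> will bound the finite sums of
    \<open>h u i j\<close>.\<close>
  define B where "B i j = (if j = i then K j else A j)" for i j
  define h where "h u i j k = \<bar>c j (u $ j - real_of_int k)\<bar> *
      (if j = i then \<bar>u $ j - real_of_int k\<bar> powr \<beta> else 1)" for u :: "real^'n" and i j k
  have h0: "h u i j k \<ge> 0" for u i j k
    by (simp add: h_def)
  have hB: "sum (h u i j) S \<le> B i j" if "finite S" for u i j S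
    using A[OF that] K[OF that] by (simp add: h_def B_def)
  have *: "\<bar>product_function c (u - lattice_point k)\<bar> * norm (u - lattice_point k) powr \<beta>
      \<le> n powr \<beta> * (\<Sum>i\<in>UNIV. \<Prod>j\<in>UNIV. h u i j (k $ j))" for u k
  proof -
    let ?v = "u - lattice_point k"
    obtain i where i: "norm ?v \<le> n * \<bar>?v $ i\<bar>"
      unfolding n_def by (rule norm_le_card_mult_component)
    have "norm ?v powr \<beta> \<le> (n * \<bar>?v $ i\<bar>) powr \<beta>"
      using i assms(1) by (intro powr_mono2) auto
    also have "\<dots> = n powr \<beta> * \<bar>?v $ i\<bar> powr \<beta>"
      by (simp add: n_def powr_mult)
    finally have "\<bar>product_function c ?v\<bar> * norm ?v powr \<beta>
        \<le> n powr \<beta> * (\<bar>product_function c ?v\<bar> * \<bar>?v $ i\<bar> powr \<beta>)"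
      using mult_left_mono[of _ _ "\<bar>product_function c ?v\<bar>"]
      by (metis abs_ge_zero mult.left_commute)
    also have "\<bar>product_function c ?v\<bar> * \<bar>?v $ i\<bar> powr \<beta> = (\<Prod>j\<in>UNIV. h u i j (k $ j))"
      by (simp add: h_def product_function_def lattice_point_def abs_prod prod.distrib prod.delta)
    \<comment> \<open>The dominant coordinate \<open>i\<close> depends on \<open>u\<close> and
      \<open>k\<close>; summing over all coordinates removes this dependence.\<close>
    also have "\<dots> \<le> (\<Sum>i\<in>UNIV. \<Prod>j\<in>UNIV. h u i j (k $ j))"
      by (rule member_le_sum) (auto intro!: prod_nonneg h0)
    finally show ?thesis
      by (simp add: mult_left_mono)
  qed
  have "(\<Sum>k\<in>F. \<bar>product_function c (u - lattice_point k)\<bar> * norm (u - lattice_point k) powr \<beta>)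
      \<le> n powr \<beta> * (\<Sum>i\<in>UNIV. \<Prod>j\<in>UNIV. B i j)" if F: "finite F" for u F
  proof -
    have "(\<Sum>k\<in>F. \<bar>product_function c (u - lattice_point k)\<bar> * norm (u - lattice_point k) powr \<beta>)
        \<le> (\<Sum>k\<in>F. n powr \<beta> * (\<Sum>i\<in>UNIV. \<Prod>j\<in>UNIV. h u i j (k $ j)))"
      by (intro sum_mono *)
    also have "\<dots> = n powr \<beta> * (\<Sum>i\<in>UNIV. \<Sum>k\<in>F. \<Prod>j\<in>UNIV. h u i j (k $ j))"
      by (subst sum.swap) (simp add: sum_distrib_left)
    also have "\<dots> \<le> n powr \<beta> * (\<Sum>i\<in>UNIV. \<Prod>j\<in>UNIV. B i j)"
      using h0 hB F by (intro mult_left_mono sum_mono finite_sum_prod_vec_le) auto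
    finally show ?thesis .
  qed
  \<comment> \<open>Each \<open>B i j\<close> bounds the empty sum and is therefore
    nonnegative.\<close>
  moreover have "n powr \<beta> * (\<Sum>i\<in>UNIV. \<Prod>j\<in>UNIV. B i j) \<ge> 0"
    using hB[of "{}"] by (intro mult_nonneg_nonneg sum_nonneg prod_nonneg) auto
  ultimately show ?thesis
    unfolding chi3_def by (subst Sup_infsum_ennreal_finite_iff) auto
qed

text \<open>The region \<open>norm u > M\<close> is covered by the sets
  \<open>\<bar>u $ i\<bar> > M / n\<close>. The power \<open>w ^ CARD('n)\<close> gives one
  \<open>w\<close> to each coordinate, so the integral over the \<open>i\<close>-th set is the
  one-dimensional tail of \<open>c i\<close> times constants independent of
  \<open>w\<close>.\<close>

lemma chi4_product_function:
  fixes c :: "'n::finite \<Rightarrow> real \<Rightarrow> real"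
  assumes c: "\<And>i. integrable lebesgue (c i)"
    and tail: "\<And>i M. M > 0 \<Longrightarrow>
           (\<lambda>w. LINT x:{x. \<bar>x\<bar> > M}|lebesgue. w * \<bar>c i (w * x)\<bar>) \<in> O[at_top](\<lambda>w. w powr (- \<alpha>))"
  shows "chi4 \<alpha> (product_function c)"
  unfolding chi4_def
proof (intro allI impI)
  fix M :: real
  assume M: "M > 0"
  define n where "n = real CARD('n)"
  have n: "n > 0"
    by (simp add: n_def)
  define T where "T i w = (LINT x:{x. \<bar>x\<bar> > M / n}|lebesgue. w * \<bar>c i (w * x)\<bar>)" for i w
  define L where "L j = (LINT y|lebesgue. \<bar>c j y\<bar>)" for j
  define h where "h w i j y = (if j = i then indicator {x. \<bar>x\<bar> > M / n} y else 1) * (w * \<bar>c j (w * y)\<bar>)"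
    for w i j and y :: real
  let ?I = "\<lambda>w. LINT u:{u::real^'n. norm u > M}|lebesgue. w ^ CARD('n) * \<bar>product_function c (w *\<^sub>R u)\<bar>"
  have bound: "norm (?I w) \<le> norm (\<Sum>i\<in>UNIV. (\<Prod>j\<in>UNIV - {i}. L j) * T i w)" if w: "w > 0" for w
  proof -
    have h0: "h w i j y \<ge> 0" for i j y
      using w by (simp add: h_def)
    have int: "integrable lebesgue (\<lambda>y. w * \<bar>c j (w * y)\<bar>)" for j
      using integrable_lebesgue_scale[OF c, of w j] w by auto
    have "{x::real. \<bar>x\<bar> > M / n} \<in> sets lebesgue"
      by simp
    then have hint: "integrable lebesgue (h w i j)" for i j
      using int[of j] integrable_mult_indicator[OF _ int[of j], of "{x. \<bar>x\<bar> > M / n}"]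
      by (cases "j = i") (simp_all add: h_def[abs_def])
    have hprod: "integrable lebesgue (\<lambda>u. \<Prod>j\<in>UNIV. h w i j (u $ j))" for i
      by (intro integrable_lebesgue_prod_vec hint)
    \<comment> \<open>For \<open>j \<noteq> i\<close> the substitution
      \<open>y \<mapsto> w * y\<close> absorbs the factor \<open>w\<close>, leaving the full
      integral \<open>L j\<close>.\<close>
    have hL: "(LINT y|lebesgue. h w i j y) = (if j = i then T i w else L j)" for i j
      using integral_lebesgue_scale[of "\<lambda>y. \<bar>c j y\<bar>" w] c[of j] w
      by (simp add: h_def T_def L_def set_lebesgue_integral_def mult.left_commute)
    have le: "indicator {u. norm u > M} u *\<^sub>R (w ^ CARD('n) * \<bar>product_function c (w *\<^sub>R u)\<bar>)
        \<le> (\<Sum>i\<in>UNIV. \<Prod>j\<in>UNIV. h w i j (u $ j))" for u :: "real^'n"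
    proof (cases "norm u > M")
      case True
      obtain i where "norm u \<le> n * \<bar>u $ i\<bar>"
        unfolding n_def by (rule norm_le_card_mult_component)
      with True have i: "\<bar>u $ i\<bar> > M / n"
        using n by (simp add: pos_divide_less_eq mult.commute)
      have "h w i j (u $ j) = w * \<bar>c j (w * u $ j)\<bar>" for j
        using i by (simp add: h_def)
      then have "w ^ CARD('n) * \<bar>product_function c (w *\<^sub>R u)\<bar> = (\<Prod>j\<in>UNIV. h w i j (u $ j))"
        by (simp add: product_function_def abs_prod prod.distrib)
      also have "\<dots> \<le> (\<Sum>i\<in>UNIV. \<Prod>j\<in>UNIV. h w i j (u $ j))"
        by (rule member_le_sum) (auto intro!: prod_nonneg h0)
      finally show ?thesis
        using True by simp
    next
      case False
      then show ?thesis
        by (auto intro!: sum_nonneg prod_nonneg h0)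
    qed
    \<comment> \<open>\<open>integral_mono'\<close> asks for integrability and nonnegativity of the
      dominating function; if the left integrand were not integrable, its integral would be the
      default 0 and the bound would still hold.\<close>
    have "?I w \<le> (LINT u|lebesgue. (\<Sum>i\<in>UNIV. \<Prod>j\<in>UNIV. h w i j (u $ j)))"
      unfolding set_lebesgue_integral_def
      by (intro integral_mono' le Bochner_Integration.integrable_sum hprod sum_nonneg prod_nonneg h0)
    also have "\<dots> = (\<Sum>i\<in>UNIV. \<Prod>j\<in>UNIV. if j = i then T i w else L j)"
      using hprod by (simp add: Bochner_Integration.integral_sum integral_lebesgue_prod_vec[OF hint] hL)
    also have "\<dots> = (\<Sum>i\<in>UNIV. (\<Prod>j\<in>UNIV - {i}. L j) * T i w)"
    proof (rule sum.cong)
      fix i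
      show "(\<Prod>j\<in>UNIV. if j = i then T i w else L j) = (\<Prod>j\<in>UNIV - {i}. L j) * T i w"
        by (subst prod.remove[of _ i]) auto
    qed simp
    finally have "?I w \<le> \<dots>" .
    moreover have "?I w \<ge> 0"
      unfolding set_lebesgue_integral_def using w by (intro Bochner_Integration.integral_nonneg) auto
    ultimately show ?thesis by simp
  qed
  have "?I \<in> O[at_top](\<lambda>w. \<Sum>i\<in>UNIV. (\<Prod>j\<in>UNIV - {i}. L j) * T i w)"
    by (intro landau_o.big_mono eventually_mono[OF eventually_gt_at_top[of 0]] bound)
  also have "(\<lambda>w. \<Sum>i\<in>UNIV. (\<Prod>j\<in>UNIV - {i}. L j) * T i w) \<in> O[at_top](\<lambda>w. w powr (- \<alpha>))"
  proof (rule big_sum_in_bigo)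
    fix i
    have "T i \<in> O[at_top](\<lambda>w. w powr (- \<alpha>))"
      unfolding T_def[abs_def] using M n by (intro tail) simp
    then show "(\<lambda>w. (\<Prod>j\<in>UNIV - {i}. L j) * T i w) \<in> O[at_top](\<lambda>w. w powr (- \<alpha>))"
      by simp
  qed
  finally show "?I \<in> O[at_top](\<lambda>w. w powr (- \<alpha>))" .
qed

theorem mainTheorem3:
  fixes c :: "'n::finite \<Rightarrow> real \<Rightarrow> real" and \<alpha> \<beta> :: real
  assumes "\<beta> > 0" and "\<alpha> > 0"
    and "\<And>i. integrable lebesgue (c i)"
    and "\<And>i. Bfun (c i) (nhds 0)"
    and "\<And>i. (SUP x. \<Sum>\<^sub>\<infinity>k::int. ennreal (\<bar>c i (x - real_of_int k)\<bar> * \<bar>x - real_of_int k\<bar> powr \<beta>)) < \<infinity>"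
    and "\<And>i x. ((\<lambda>k::int. c i (x - real_of_int k)) has_sum 1) UNIV"
    and "\<And>i M. M > 0 \<Longrightarrow>
           (\<lambda>w. LINT x:{x. \<bar>x\<bar> > M}|lebesgue. w * \<bar>c i (w * x)\<bar>) \<in> O[at_top](\<lambda>w. w powr (- \<alpha>))"
  shows "is_kernel (product_function c) \<and>
         chi1 (product_function c) \<and>
         (\<forall>\<mu>>0. chi2 \<mu> (product_function c)) \<and>
         (\<forall>x. \<forall>w>0. ((\<lambda>k. product_function c (w *\<^sub>R x - lattice_point k)) has_sum 1) UNIV) \<and>
         chi3 \<beta> (product_function c) \<and>
         chi4 \<alpha> (product_function c)"
proof -
  have 1: "chi1 (product_function c)"
    using assms(3,4) by (rule chi1_product_function)
  have 2: "chi2 \<mu> (product_function c)" for \<mu>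
    using assms(6) by (rule chi2_product_function)
  have 3: "chi3 \<beta> (product_function c)"
    using assms(1,4,5) by (rule chi3_product_function)
  have 4: "chi4 \<alpha> (product_function c)"
    using assms(3,7) by (rule chi4_product_function)
  \<comment> \<open>The witness for \<open>\<mu>\<close> is 1; those for the other two exponents are
    the given \<open>\<beta>\<close> and \<open>\<alpha>\<close>.\<close>
  have "is_kernel (product_function c)"
    unfolding is_kernel_def using 1 2 3 4 assms(1,2) zero_less_one by blast
  with 1 2 3 4 show ?thesis
    using has_sum_product_function[where c=c, OF assms(6)] by blast
qed

end
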